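(* Let $A=[a_{ij}]\in\mathbb{C}^{n\times n}$ and let $S$ be any nonempty subset of $N=\{1,\dots,n\}$. Then \[ \sigma(A)\subseteq \Xi^{S}(A):=\begin{cases}\widehat{\Xi}^{S}(A) & \text{if } \emptyset\neq S\subsetneq N,\\ \Omega(A) & \text{if } S=N.\end{cases} \]
   Context: $\sigma(A)$ denotes the set of all eigenvalues of $A$. $\overline{S}=N\setminus S$. For $i\in N$ and $T\subseteq N$ put $r_i^T=\sum_{j\in T\setminus\{i\}}|a_{ij}|$, and $r_i=r_i^N=\sum_{j\in N\setminus\{i\}}|a_{ij}|$. For a nonempty proper subset $S$ of $N$, and $i\in S$, $j\in\overline{S}$, define \[ W_{ij}^S(A)=\Big\{z\in\mathbb{C}: \max\{0,|z-a_{ii}|-r_i^S\}\cdot\max\{0,|z-a_{jj}|-r_j^{\overline{S}}\}\le r_i^{\overline{S}}\,r_j^S\Big\}, \] \[ \Psi_{ij}^S(A)=\Big\{z\in\mathbb{C}: \big(|z-a_{ii}|+r_i^S\big)\big(|z-a_{jj}|+r_j^{\overline{S}}\big)<\max\{0,2|a_{ij}|-r_i^{\overline{S}}\}\cdot\max\{0,2|a_{ji}|-r_j^S\}\Big\}, \] and $\widehat{\Xi}^{S}(A)=\bigcup_{i\in S,\,j\in\overline{S}}\big(W_{ij}^S(A)\setminus\Psi_{ij}^S(A)\big)$. The Geršgorin inclusion-exclusion set is $\Omega(A)=\bigcup_{i\in N}\big(\Gamma_i(A)\setminus\Delta_i(A)\big)$, where $\Gamma_i(A)=\{z\in\mathbb{C}:|z-a_{ii}|\le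 r_i\}$ and $\Delta_i(A)=\bigcup_{k\in N\setminus\{i\}}\{z\in\mathbb{C}:|z-a_{kk}|<2|a_{ki}|-r_k\}$. *)

theory Defs
  imports "Jordan_Normal_Form.Spectral_Radius"
begin

text \<open>The index set \<open>N\<close> of a matrix is \<open>{..<dim_row A}\<close>, since matrix entries are indexed from 0.\<close>

definition index_set :: "complex mat \<Rightarrow> nat set" where
  "index_set A = {..<dim_row A}"

definition row_sum_on :: "complex mat \<Rightarrow> nat set \<Rightarrow> nat \<Rightarrow> real" where
  "row_sum_on A T i = (\<Sum>j\<in>T - {i}. cmod (A $$ (i, j)))"

definition row_sum :: "complex mat \<Rightarrow> nat \<Rightarrow> real" where
  "row_sum A i = row_sum_on A (index_set A) i"

definition W_set :: "complex mat \<Rightarrow> nat set \<Rightarrow> nat \<Rightarrow> nat \<Rightarrow> complex set" where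
  "W_set A S i j = {z.
     max 0 (cmod (z - A $$ (i, i)) - row_sum_on A S i)
     * max 0 (cmod (z - A $$ (j, j)) - row_sum_on A (index_set A - S) j)
     \<le> row_sum_on A (index_set A - S) i * row_sum_on A S j}"

definition Psi_set :: "complex mat \<Rightarrow> nat set \<Rightarrow> nat \<Rightarrow> nat \<Rightarrow> complex set" where
  "Psi_set A S i j = {z.
     (cmod (z - A $$ (i, i)) + row_sum_on A S i)
     * (cmod (z - A $$ (j, j)) + row_sum_on A (index_set A - S) j)
     < max 0 (2 * cmod (A $$ (i, j)) - row_sum_on A (index_set A - S) i)
       * max 0 (2 * cmod (A $$ (j, i)) - row_sum_on A S j)}"

definition Xi_hat :: "complex mat \<Rightarrow> nat set \<Rightarrow> complex set" where
  "Xi_hat A S = (\<Union>i\<in>S. \<Union>j\<in>index_set A - S. W_set A S i j - Psi_set A S i j)"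

definition gershgorin_disk :: "complex mat \<Rightarrow> nat \<Rightarrow> complex set" where
  "gershgorin_disk A i = {z. cmod (z - A $$ (i, i)) \<le> row_sum A i}"

definition exclusion_set :: "complex mat \<Rightarrow> nat \<Rightarrow> complex set" where
  "exclusion_set A i =
     (\<Union>k\<in>index_set A - {i}. {z. cmod (z - A $$ (k, k)) < 2 * cmod (A $$ (k, i)) - row_sum A k})"

definition Omega_set :: "complex mat \<Rightarrow> complex set" where
  "Omega_set A = (\<Union>i\<in>index_set A. gershgorin_disk A i - exclusion_set A i)"

definition Xi_set :: "complex mat \<Rightarrow> nat set \<Rightarrow> complex set" where
  "Xi_set A S = (if S = index_set A then Omega_set A else Xi_hat A S)"

end

(* For an eigenvector x of A with eigenvalue z, let i and j maximise the modulus of the entries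
   of x over S and over its complement. Isolating the diagonal term in rows i and j bounds
   |x_i| by |x_j| and conversely; multiplying the two bounds puts z into W. Isolating the terms
   a_ij x_j and a_ji x_i instead, and multiplying again, keeps z out of Psi. For S = N the same row
   bounds apply to the partition of N into a single row index and its complement. *)
theory Submission
  imports Defs
begin

lemma row_sum_on_nonneg: "0 \<le> row_sum_on A T i"
  unfolding row_sum_on_def by (intro sum_nonneg) simp

lemma eigenvector_row:
  assumes A: "A \<in> carrier_mat n n" and x: "eigenvector A x z" and i: "i < n"
  shows "(z - A $$ (i, i)) * x $ i = (\<Sum>k\<in>{..<n} - {i}. A $$ (i, k) * x $ k)"
proof -
  have d: "dim_vec x = n" and e: "A *\<^sub>v x = z \<cdot>\<^sub>v x"
    using A x unfolding eigenvector_def by auto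
  have "z * x $ i = (A *\<^sub>v x) $ i"
    using e d i by simp
  also have "\<dots> = (\<Sum>k\<in>{..<n}. A $$ (i, k) * x $ k)"
    using A d i by (simp add: scalar_prod_def lessThan_atLeast0)
  also have "\<dots> = A $$ (i, i) * x $ i + (\<Sum>k\<in>{..<n} - {i}. A $$ (i, k) * x $ k)"
    using i by (subst sum.remove[of _ i]) auto
  finally show ?thesis
    by (simp add: algebra_simps)
qed

lemma norm_sum_le_weighted:
  fixes f g :: "'a \<Rightarrow> complex"
  assumes "\<And>k. k \<in> T \<Longrightarrow> cmod (g k) \<le> m"
  shows "cmod (\<Sum>k\<in>T. f k * g k) \<le> (\<Sum>k\<in>T. cmod (f k)) * m"
proof -
  have "cmod (\<Sum>k\<in>T. f k * g k) \<le> (\<Sum>k\<in>T. cmod (f k) * m)"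
    by (intro sum_norm_le) (auto simp: norm_mult intro!: mult_left_mono assms)
  then show ?thesis
    by (simp add: sum_distrib_right)
qed

text \<open>Both bounds are the triangle inequality applied to row \<open>i\<close> of the
  eigenvector equation, with its off-diagonal sum split along the partition. The bounds
  \<open>p\<close> and \<open>q\<close> stay abstract, so that the two blocks can be exchanged and
  \<open>q\<close> need not be attained.\<close>

lemma
  assumes A: "A \<in> carrier_mat n n" and x: "eigenvector A x z"
    and part: "S \<union> T = {..<n}" "S \<inter> T = {}" and i: "i \<in> S"
    and S: "\<And>k. k \<in> S \<Longrightarrow> cmod (x $ k) \<le> p"
    and T: "\<And>k. k \<in> T \<Longrightarrow> cmod (x $ k) \<le> q"
  shows diag_entry_bound:
      "cmod (z - A $$ (i, i)) * cmod (x $ i) \<le> row_sum_on A S i * p + row_sum_on A T i * q"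
    and offdiag_entry_bound: "\<And>j. j \<in> T \<Longrightarrow>
      cmod (A $$ (i, j)) * cmod (x $ j)
      \<le> cmod (z - A $$ (i, i)) * cmod (x $ i) + row_sum_on A S i * p
        + (row_sum_on A T i - cmod (A $$ (i, j))) * q"
proof -
  define f where "f k = A $$ (i, k) * x $ k" for k
  have fin: "finite S" "finite T"
    using part by (metis finite_Un finite_lessThan)+
  have iT: "T - {i} = T"
    using part i by auto
  have "(z - A $$ (i, i)) * x $ i = sum f ({..<n} - {i})"
    unfolding f_def by (rule eigenvector_row[OF A x]) (use part i in auto)
  also have "{..<n} - {i} = (S - {i}) \<union> T"
    using part i by auto
  also have "sum f \<dots> = sum f (S - {i}) + sum f T"
    using fin part by (intro sum.union_disjoint) auto
  finally have row: "(z - A $$ (i, i)) * x $ i = sum f (S - {i}) + sum f T" .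
  have bS: "cmod (sum f (S - {i})) \<le> row_sum_on A S i * p"
    unfolding f_def row_sum_on_def using S by (intro norm_sum_le_weighted) auto
  have bT: "cmod (sum f T) \<le> row_sum_on A T i * q"
    unfolding f_def row_sum_on_def iT using T by (intro norm_sum_le_weighted) auto
  show "cmod (z - A $$ (i, i)) * cmod (x $ i) \<le> row_sum_on A S i * p + row_sum_on A T i * q"
    unfolding norm_mult[symmetric] row by (rule norm_triangle_le) (use bS bT in linarith)
  fix j assume j: "j \<in> T"
  have bTj: "cmod (sum f (T - {j})) \<le> (row_sum_on A T i - cmod (A $$ (i, j))) * q"
  proof -
    have "row_sum_on A T i - cmod (A $$ (i, j)) = (\<Sum>k\<in>T - {j}. cmod (A $$ (i, k)))"
      unfolding row_sum_on_def iT using fin j by (simp add: sum_diff1)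
    then show ?thesis
      unfolding f_def using T by (auto intro: norm_sum_le_weighted)
  qed
  \<comment> \<open>The row equation is solved for the single term with column \<open>j\<close>; the
    rest of the \<open>T\<close>-sum was bounded in \<open>bTj\<close>.\<close>
  have "A $$ (i, j) * x $ j = (z - A $$ (i, i)) * x $ i - sum f (S - {i}) - sum f (T - {j})"
    unfolding row using fin j by (simp add: sum_diff1 f_def)
  then have "cmod (A $$ (i, j) * x $ j) \<le> cmod ((z - A $$ (i, i)) * x $ i)
      + cmod (sum f (S - {i})) + cmod (sum f (T - {j}))"
    by (metis add_right_mono norm_triangle_ineq4 order_trans)
  then show "cmod (A $$ (i, j)) * cmod (x $ j)
      \<le> cmod (z - A $$ (i, i)) * cmod (x $ i) + row_sum_on A S i * p
        + (row_sum_on A T i - cmod (A $$ (i, j))) * q"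
    using bS bTj unfolding norm_mult by linarith
qed

text \<open>Multiplying the two hypotheses \<open>ac\<close> and \<open>bd\<close> puts the factor
  \<open>p * q\<close> on both sides, and it cancels when positive. Truncation at 0 disposes of
  nonpositive \<open>a\<close> or \<open>b\<close>.\<close>

lemma max_prod_le:
  fixes a b c d p q :: real
  assumes "0 \<le> p" "0 \<le> q" "0 < p \<or> 0 < q" "0 \<le> c" "0 \<le> d"
    and ac: "a * p \<le> c * q" and bd: "b * q \<le> d * p"
  shows "max 0 a * max 0 b \<le> c * d"
proof (cases "a \<le> 0 \<or> b \<le> 0")
  case True
  then show ?thesis
    using assms by auto
next
  case False
  then have ab: "0 < a" "0 < b"
    by auto
  \<comment> \<open>If only \<open>p\<close> vanished, \<open>bd\<close> would force
    \<open>b * q \<le> 0\<close>; if only \<open>q\<close> vanished, \<open>ac\<close> would force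
    \<open>a * p \<le> 0\<close>.\<close>
  have "0 < p \<and> 0 < q"
  proof (rule ccontr)
    assume "\<not> (0 < p \<and> 0 < q)"
    then consider "p = 0" "0 < q" | "q = 0" "0 < p"
      using assms(1-3) by linarith
    then show False
      using ac bd ab by cases (auto simp: mult_le_0_iff)
  qed
  moreover have "(a * p) * (b * q) \<le> (c * q) * (d * p)"
    using mult_mono[OF ac bd] assms ab by simp
  then have "(a * b) * (p * q) \<le> (c * d) * (p * q)"
    by (simp add: mult_ac)
  ultimately show ?thesis
    using ab by simp
qed

lemma ex_max_norm_entry:
  assumes "finite S" "S \<noteq> {}"
  obtains i where "i \<in> S" "\<And>k. k \<in> S \<Longrightarrow> cmod (x $ k) \<le> cmod (x $ i)"
proof -
  let ?f = "\<lambda>k. cmod (x $ k)"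
  have "Max (?f ` S) \<in> ?f ` S"
    using assms by (intro Max_in) auto
  then obtain i where i: "i \<in> S" "?f i = Max (?f ` S)"
    by auto
  show ?thesis
    by (rule that[OF i(1)]) (use assms i in auto)
qed

lemma eigenvector_nonzero_entry:
  assumes "A \<in> carrier_mat n n" "eigenvector A x z"
  obtains k where "k < n" "x $ k \<noteq> 0"
  using assms unfolding eigenvector_def by (metis carrier_matD(1) carrier_vecD eq_vecI index_zero_vec)

text \<open>One pair of indices has to witness both membership in \<open>W_set\<close> and exclusion
  from \<open>Psi_set\<close>; the maximisers over the two blocks do both.\<close>

lemma eigenvalue_in_Xi_hat:
  assumes A: "A \<in> carrier_mat n n" and x: "eigenvector A x z"
    and S: "S \<noteq> {}" "S \<subset> {..<n}"
  shows "z \<in> Xi_hat A S"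
proof -
  define T where "T = {..<n} - S"
  have N: "index_set A - S = T"
    using A unfolding index_set_def T_def by auto
  have T: "finite T" "T \<noteq> {}" and finS: "finite S"
    using S unfolding T_def by (auto intro: finite_subset)
  have part: "S \<union> T = {..<n}" "S \<inter> T = {}" "T \<union> S = {..<n}" "T \<inter> S = {}"
    using S unfolding T_def by auto
  obtain i where i: "i \<in> S" and maxi: "\<And>k. k \<in> S \<Longrightarrow> cmod (x $ k) \<le> cmod (x $ i)"
    using ex_max_norm_entry[OF finS S(1)] by blast
  obtain j where j: "j \<in> T" and maxj: "\<And>k. k \<in> T \<Longrightarrow> cmod (x $ k) \<le> cmod (x $ j)"
    using ex_max_norm_entry[OF T] by blast
  obtain k where k: "k < n" "x $ k \<noteq> 0"
    using eigenvector_nonzero_entry[OF A x] .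
  then have "cmod (x $ k) \<le> cmod (x $ i) \<or> cmod (x $ k) \<le> cmod (x $ j)" "0 < cmod (x $ k)"
    using maxi maxj part by auto
  \<comment> \<open>The eigenvector may vanish on a whole block, so only one of the two maxima is
    sure to be positive.\<close>
  then have pos: "0 < cmod (x $ i) \<or> 0 < cmod (x $ j)"
    by linarith
  have "z \<in> W_set A S i j"
    unfolding W_set_def N mem_Collect_eq
    using diag_entry_bound[OF A x part(1,2) i maxi maxj]
      diag_entry_bound[OF A x part(3,4) j maxj maxi] pos
    by (intro max_prod_le[of "cmod (x $ i)" "cmod (x $ j)"])
      (auto simp: row_sum_on_nonneg algebra_simps)
  \<comment> \<open>The weights trade places here, because the isolated term carries the entry from
    the opposite block. The factor 2 appears when \<open>- cmod (A $$ (i, j)) * cmod (x $ j)\<close>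
    moves to the left of the bound.\<close>
  moreover have "z \<notin> Psi_set A S i j"
    unfolding Psi_set_def N mem_Collect_eq not_less
    using offdiag_entry_bound[OF A x part(1,2) i maxi maxj j]
      offdiag_entry_bound[OF A x part(3,4) j maxj maxi i] pos
    by (intro max_prod_le[of "cmod (x $ j)" "cmod (x $ i)"])
      (auto simp: row_sum_on_nonneg algebra_simps)
  ultimately show ?thesis
    unfolding Xi_hat_def N using i j by blast
qed

lemma row_sum_on_singleton: "row_sum_on A {i} i = 0"
  by (simp add: row_sum_on_def)

text \<open>Here \<open>i\<close> maximises over all indices, and each row \<open>k\<close> is read
  off the partition into \<open>{k}\<close> and the rest, where the sum over the own block is
  empty.\<close>

lemma eigenvalue_in_Omega_set:
  assumes A: "A \<in> carrier_mat n n" and x: "eigenvector A x z"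
  shows "z \<in> Omega_set A"
proof -
  have N: "index_set A = {..<n}"
    using A unfolding index_set_def by auto
  obtain l where l: "l < n" "x $ l \<noteq> 0"
    using eigenvector_nonzero_entry[OF A x] .
  then obtain i where i: "i < n" and maxi: "\<And>k. k < n \<Longrightarrow> cmod (x $ k) \<le> cmod (x $ i)"
    using ex_max_norm_entry[of "{..<n}" x] by (metis empty_iff finite_lessThan lessThan_iff)
  have pos: "0 < cmod (x $ i)"
    using l maxi[of l] by (metis norm_le_zero_iff not_le zero_less_norm_iff order_less_le_trans)
  have part: "{k} \<union> ({..<n} - {k}) = {..<n}" "{k} \<inter> ({..<n} - {k}) = {}" if "k < n" for k
    using that by auto
  have r: "row_sum_on A ({..<n} - {k}) k = row_sum A k" for k
    unfolding row_sum_def N row_sum_on_def by simp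
  have "cmod (z - A $$ (i, i)) * cmod (x $ i) \<le> row_sum A i * cmod (x $ i)"
    using diag_entry_bound[OF A x part[OF i], of i "cmod (x $ i)" "cmod (x $ i)"] maxi
    by (auto simp: r row_sum_on_singleton)
  then have "z \<in> gershgorin_disk A i"
    unfolding gershgorin_disk_def using pos by simp
  \<comment> \<open>Row \<open>k\<close> is used with the term in column \<open>i\<close> isolated.
    Global maximality then replaces \<open>cmod (x $ k)\<close> by \<open>cmod (x $ i)\<close>,
    which is positive and cancels.\<close>
  moreover have "2 * cmod (A $$ (k, i)) - row_sum A k \<le> cmod (z - A $$ (k, k))"
    if k: "k < n" "k \<noteq> i" for k
  proof -
    have "cmod (A $$ (k, i)) * cmod (x $ i)
        \<le> cmod (z - A $$ (k, k)) * cmod (x $ k)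
          + (row_sum A k - cmod (A $$ (k, i))) * cmod (x $ i)"
      using offdiag_entry_bound[OF A x part[OF k(1)], of k "cmod (x $ k)" "cmod (x $ i)" i]
        maxi i k
      by (auto simp: r row_sum_on_singleton)
    also have "cmod (z - A $$ (k, k)) * cmod (x $ k) \<le> cmod (z - A $$ (k, k)) * cmod (x $ i)"
      using maxi[OF k(1)] by (rule mult_left_mono) simp
    finally have "(2 * cmod (A $$ (k, i)) - row_sum A k) * cmod (x $ i)
        \<le> cmod (z - A $$ (k, k)) * cmod (x $ i)"
      by (simp add: algebra_simps)
    then show ?thesis
      using pos by simp
  qed
  then have "z \<notin> exclusion_set A i"
    unfolding exclusion_set_def N by (auto simp: not_less)
  ultimately show ?thesis
    unfolding Omega_set_def N using i by blast
qed

theorem corollary3p2: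
  fixes A :: "complex mat" and n :: nat and S :: "nat set"
  assumes "A \<in> carrier_mat n n"
    and "S \<noteq> {}"
    and "S \<subseteq> {..<n}"
  shows "spectrum A \<subseteq> Xi_set A S"
proof
  fix z assume "z \<in> spectrum A"
  then obtain x where x: "eigenvector A x z"
    unfolding spectrum_def eigenvalue_def by auto
  have N: "index_set A = {..<n}"
    using assms(1) unfolding index_set_def by auto
  show "z \<in> Xi_set A S"
    unfolding Xi_set_def N
    using eigenvalue_in_Omega_set[OF assms(1) x] eigenvalue_in_Xi_hat[OF assms(1) x assms(2)] assms(3)
    by auto
qed

end
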